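(* Let $f:\{0,1\}^n\times\{0,1\}^n\times\{0,1\}^n\to\{0,1\}$ be a Boolean function, and let $f^i$ and $f^j$ be any two distinct induced functions of $f$ (with $i\neq j\in\{1,2,3\}$). Assume the Log-Rank Conjecture for $3$-party computation holds with a constant $c'>0$, i.e. for every $n$ and every $g:(\{0,1\}^n)^3\to\{0,1\}$ we have $D(g)=O\big((\log \operatorname{rank}(M_g))^{c'}\big)$. Then $D(f)=O\big((D(f^i)+D(f^j))^{c'}\big)$.
   Context: For a $k$-argument Boolean function $g:(\{0,1\}^n)^k\to\{0,1\}$, $D(g)$ denotes its deterministic communication complexity in the "number in hand" model: player $P_\ell$ holds $x_\ell\in\{0,1\}^n$, players communicate over a broadcast channel, and $D(g)$ is the worst-case number of bits sent by the best deterministic protocol computing $g(x_1,\dots,x_k)$; for $k=2$ this is the usual two-party deterministic complexity. $M_g$ is the $k$-dimensional $2^n\times\cdots\times 2^n$ array with $M_g[x_1,\dots,x_k]=g(x_1,\dots,x_k)$, and $\operatorname{rank}(M_g)$ is its tensor rank over the reals: the minimal $r$ such that $M_g$ is a sum of $r$ arrays of the form $v_1\otimes\cdots\otimes v_k$ (entry $(j_1,\dots,j_k)$ equal to $v_1[j_1]\cdots v_k[j_k]$). For $k=3$, the induced functions are the two-argument functions $f^1:=f^{\{1\},\{2,3\}}$, $f^2:=f^{\{2\},\{1,3\}}$, $f^3:=f^{\{3\},\{1,2\}}$, where for a partition $A,B$ of the players, $f^{A,B}(\{x_\ell\}_{\ell\in A},\{x_\ell\}_{\ell\in B})=f(x_1,x_2,x_3)$,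 viewed as a two-party function (one party holding the inputs indexed by $A$, the other those indexed by $B$). *)

theory Defs
  imports "HOL-Analysis.Analysis"
begin

text \<open>
  Throughout, a \<^term>\<open>k\<close>-argument function is a function of a single argument \<^term>\<open>x\<close>, a family of
  inputs in which \<^term>\<open>x l\<close> is the input of player \<^term>\<open>l\<close>. Player \<^term>\<open>l \<in> I\<close> has the
  input set \<^term>\<open>X l\<close>, so the set of inputs is \<^term>\<open>PiE I X\<close>; values elsewhere never matter.
\<close>

subsection \<open>Deterministic number-in-hand communication\<close>

text \<open>
  At a node \<^term>\<open>Send l a P Q\<close>, player \<^term>\<open>l\<close> broadcasts the bit \<^term>\<open>a\<close> evaluated at its own input,
  and the protocol continues with \<^term>\<open>P\<close> (bit 1) or \<^term>\<open>Q\<close> (bit 0). The position in the tree is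
  the transcript so far, which is common knowledge; it determines the next speaker and, at a leaf,
  the output.
\<close>

datatype (speakers: 'p, 'x) protocol =
    Output bool
  | Send 'p "'x \<Rightarrow> bool" "('p, 'x) protocol" "('p, 'x) protocol"

primrec run :: "('p, 'x) protocol \<Rightarrow> ('p \<Rightarrow> 'x) \<Rightarrow> bool" where
  "run (Output b) x = b"
| "run (Send l a P Q) x = (if a (x l) then run P x else run Q x)"

primrec bits_sent :: "('p, 'x) protocol \<Rightarrow> ('p \<Rightarrow> 'x) \<Rightarrow> nat" where
  "bits_sent (Output b) x = 0"
| "bits_sent (Send l a P Q) x = Suc (if a (x l) then bits_sent P x else bits_sent Q x)"

definition computes ::
    "'p set \<Rightarrow> ('p \<Rightarrow> 'x set) \<Rightarrow> ('p, 'x) protocol \<Rightarrow> (('p \<Rightarrow> 'x) \<Rightarrow> bool) \<Rightarrow> bool" where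
  "computes I X P g \<longleftrightarrow> speakers P \<subseteq> I \<and> (\<forall>x \<in> PiE I X. run P x = g x)"

definition comm_complexity ::
    "'p set \<Rightarrow> ('p \<Rightarrow> 'x set) \<Rightarrow> (('p \<Rightarrow> 'x) \<Rightarrow> bool) \<Rightarrow> nat" where
  "comm_complexity I X g =
     (LEAST d. \<exists>P. computes I X P g \<and> (\<forall>x \<in> PiE I X. bits_sent P x \<le> d))"

subsection \<open>Real tensor rank\<close>

definition tensor_rank ::
    "'p set \<Rightarrow> ('p \<Rightarrow> 'x set) \<Rightarrow> (('p \<Rightarrow> 'x) \<Rightarrow> real) \<Rightarrow> nat" where
  "tensor_rank I X M =
     (LEAST r. \<exists>v :: nat \<Rightarrow> 'p \<Rightarrow> 'x \<Rightarrow> real.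
        \<forall>x \<in> PiE I X. M x = (\<Sum>s<r. \<Prod>l\<in>I. v s l (x l)))"

subsection \<open>Boolean functions of bit strings\<close>

definition bit_strings :: "nat \<Rightarrow> bool list set" where
  "bit_strings n = {w. length w = n}"

definition boolfun_complexity :: "nat \<Rightarrow> nat \<Rightarrow> ((nat \<Rightarrow> bool list) \<Rightarrow> bool) \<Rightarrow> nat" where
  "boolfun_complexity k n g = comm_complexity {1..k} (\<lambda>l. bit_strings n) g"

definition boolfun_rank :: "nat \<Rightarrow> nat \<Rightarrow> ((nat \<Rightarrow> bool list) \<Rightarrow> bool) \<Rightarrow> nat" where
  "boolfun_rank k n g = tensor_rank {1..k} (\<lambda>l. bit_strings n) (\<lambda>x. of_bool (g x))"

text \<open>
  The constant hidden in the O-notation depends neither on \<^term>\<open>n\<close> nor on \<^term>\<open>g\<close>. The bound is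
  required only when the rank is at least 2: otherwise its right-hand side is 0, while
  functions of rank 1, such as the conjunction of one bit of each player, need not be constant, so
  without the restriction no constant \<^term>\<open>c\<close> would satisfy the condition.
\<close>

definition log_rank_conjecture :: "nat \<Rightarrow> real \<Rightarrow> bool" where
  "log_rank_conjecture k c \<longleftrightarrow>
     (\<exists>C>0. \<forall>n g. boolfun_rank k n g \<ge> 2 \<longrightarrow>
        real (boolfun_complexity k n g) \<le> C * (log 2 (real (boolfun_rank k n g))) powr c)"

subsection \<open>Induced two-party functions\<close>

text \<open>
  The two parties are numbered 1 and 2. Party 1 holds the subfamily of inputs indexed by
  \<^term>\<open>A\<close> and party 2 the one indexed by \<^term>\<open>B\<close>.
\<close>

definition induced ::
    "nat set \<Rightarrow> nat set \<Rightarrow> ((nat \<Rightarrow> bool list) \<Rightarrow> bool) \<Rightarrow> (nat \<Rightarrow> nat \<Rightarrow> bool list) \<Rightarrow> bool" where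
  "induced A B f y = f (merge A B (y 1, y 2))"

definition induced_inputs :: "nat \<Rightarrow> nat set \<Rightarrow> nat set \<Rightarrow> nat \<Rightarrow> (nat \<Rightarrow> bool list) set" where
  "induced_inputs n A B p = (if p = 1 then A else B) \<rightarrow>\<^sub>E bit_strings n"

definition induced_complexity ::
    "nat \<Rightarrow> nat set \<Rightarrow> nat set \<Rightarrow> ((nat \<Rightarrow> bool list) \<Rightarrow> bool) \<Rightarrow> nat" where
  "induced_complexity n A B f = comm_complexity {1, 2} (induced_inputs n A B) (induced A B f)"

end

theory Submission
  imports Defs
begin

text \<open>
  Splitting a protocol along its leaves writes the two-party function \<open>f\<^sup>i\<close> as a sum of at most
  \<open>2 ^ D(f\<^sup>i)\<close> products, and likewise for \<open>f\<^sup>j\<close>. Consequently at most \<open>2 ^ D(f\<^sup>i)\<close> of the slices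
  \<open>f(x\<^sub>i = a)\<close> span all of them, and each of these spanning slices is, by the decomposition of
  \<open>f\<^sup>j\<close>, a sum of \<open>2 ^ D(f\<^sup>j)\<close> products of a function of \<open>x\<^sub>j\<close> and a function of the third input.
  So the tensor rank of \<open>f\<close> is at most \<open>2 ^ (D(f\<^sup>i) + D(f\<^sup>j))\<close>, and the conjecture applies.
  Functions of rank at most 1, which the conjecture does not cover, cost at most three bits, and
  \<open>f\<close> is constant when \<open>D(f\<^sup>i) = 0\<close>.
\<close>

subsection \<open>Protocols\<close>

text \<open>Used in two ways: to recognise one fixed input, each player comparing its own part, and
  to evaluate a single product, each player testing its factor for being nonzero.\<close>

primrec conj_protocol ::
    "'p list \<Rightarrow> ('p \<Rightarrow> 'x \<Rightarrow> bool) \<Rightarrow> ('p, 'x) protocol \<Rightarrow> ('p, 'x) protocol \<Rightarrow> ('p, 'x) protocol" where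
  "conj_protocol [] a P Q = P"
| "conj_protocol (l # ls) a P Q = Send l (a l) (conj_protocol ls a P Q) Q"

lemma run_conj_protocol:
  "run (conj_protocol ls a P Q) x = (if \<forall>l\<in>set ls. a l (x l) then run P x else run Q x)"
  by (induction ls) auto

lemma speakers_conj_protocol:
  "speakers (conj_protocol ls a P Q) \<subseteq> set ls \<union> speakers P \<union> speakers Q"
  by (induction ls) auto

lemma bits_sent_conj_protocol_Output:
  "bits_sent (conj_protocol ls a (Output b) (Output b')) x \<le> length ls"
  by (induction ls) auto

section \<open>Existence of optimal protocols\<close>

lemma bits_sent_bounded: "\<exists>d. \<forall>x. bits_sent P x \<le> d"
proof (induction P)
  case (Send l a P Q)
  then obtain d e where "\<forall>x. bits_sent P x \<le> d" "\<forall>x. bits_sent Q x \<le> e" by blast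
  then have "\<forall>x. bits_sent (Send l a P Q) x \<le> Suc (max d e)"
    by (simp add: le_max_iff_disj)
  then show ?case by blast
qed simp

text \<open>The accepted inputs are finitely many and are added one at a time: a conjunction
  protocol recognises the new one and otherwise falls back on the protocol built so far. With the
  bounded depth of trees, this makes the \<open>LEAST\<close> in \<open>comm_complexity\<close>
  attained.\<close>

lemma computes_exists:
  assumes "finite I" "finite (PiE I X)"
  shows "\<exists>P. computes I X P g"
proof -
  obtain ls where ls: "set ls = I" using finite_list[OF assms(1)] by blast
  have "\<exists>P. computes I X P (\<lambda>x. x \<in> S)" if "finite S" "S \<subseteq> PiE I X" for S
    using that
  proof (induction S)
    case empty
    have "computes I X (Output False) (\<lambda>x. x \<in> {})" by (simp add: computes_def)
    then show ?case by blast
  next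
    case (insert y S)
    then obtain P where P: "computes I X P (\<lambda>x. x \<in> S)" by blast
    let ?Q = "conj_protocol ls (\<lambda>l z. z = y l) (Output True) P"
    have "speakers ?Q \<subseteq> I"
      using speakers_conj_protocol[of ls "\<lambda>l z. z = y l" "Output True" P] P ls
      by (auto simp: computes_def)
    moreover have "run ?Q x = (x \<in> insert y S)" if "x \<in> PiE I X" for x
    proof -
      have "(\<forall>l\<in>I. x l = y l) \<longleftrightarrow> x = y"
        using that insert.prems by (auto intro: PiE_ext)
      then show ?thesis using P that by (simp add: run_conj_protocol ls computes_def)
    qed
    ultimately show ?case unfolding computes_def by blast
  qed
  from this[of "{x \<in> PiE I X. g x}"] obtain P where
    "computes I X P (\<lambda>x. x \<in> {x \<in> PiE I X. g x})"
    using assms(2) by auto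
  then have "computes I X P g" by (simp add: computes_def)
  then show ?thesis ..
qed

lemma optimal_protocol:
  assumes "finite I" "finite (PiE I X)"
  obtains P where "computes I X P g"
    "\<And>x. x \<in> PiE I X \<Longrightarrow> bits_sent P x \<le> comm_complexity I X g"
proof -
  obtain P where P: "computes I X P g" using computes_exists[OF assms] by blast
  obtain d where "\<forall>x. bits_sent P x \<le> d" using bits_sent_bounded by blast
  with P have "\<exists>d P. computes I X P g \<and> (\<forall>x \<in> PiE I X. bits_sent P x \<le> d)" by blast
  from LeastI_ex[OF this] show thesis
    unfolding comm_complexity_def[symmetric] using that by blast
qed

lemma comm_complexity_le:
  assumes "computes I X P g" "\<And>x. x \<in> PiE I X \<Longrightarrow> bits_sent P x \<le> d"
  shows "comm_complexity I X g \<le> d"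
  unfolding comm_complexity_def using assms by (intro Least_le) blast

lemma comm_complexity_const:
  assumes "\<And>x. x \<in> PiE I X \<Longrightarrow> g x = b"
  shows "comm_complexity I X g = 0"
proof -
  have "comm_complexity I X g \<le> 0"
    by (rule comm_complexity_le[of _ _ "Output b"]) (simp_all add: computes_def assms)
  then show ?thesis by simp
qed

text \<open>A \<open>Send\<close> node costs a bit on every input, so an optimal protocol of cost 0
  is a leaf, unless there are no inputs and the claim is vacuous.\<close>

lemma comm_complexity_0_const:
  assumes "finite I" "finite (PiE I X)" "comm_complexity I X g = 0"
  shows "\<exists>b. \<forall>x \<in> PiE I X. g x = b"
proof -
  obtain P where P: "computes I X P g"
    "\<And>x. x \<in> PiE I X \<Longrightarrow> bits_sent P x \<le> comm_complexity I X g"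
    using optimal_protocol[OF assms(1,2)] by blast
  then show ?thesis using assms(3) by (cases P) (auto simp: computes_def)
qed

subsection \<open>Sums of product tensors\<close>

text \<open>The predicate minimised by \<open>tensor_rank\<close>. Keeping the number of terms
  explicit lets decompositions be combined before any minimum is taken.\<close>

definition tensor_sum ::
    "'p set \<Rightarrow> ('p \<Rightarrow> 'x set) \<Rightarrow> (('p \<Rightarrow> 'x) \<Rightarrow> real) \<Rightarrow> nat \<Rightarrow> bool" where
  "tensor_sum I X M r \<longleftrightarrow> (\<exists>v :: nat \<Rightarrow> 'p \<Rightarrow> 'x \<Rightarrow> real.
     \<forall>x \<in> PiE I X. M x = (\<Sum>s<r. \<Prod>l\<in>I. v s l (x l)))"

lemma tensor_rank_alt: "tensor_rank I X M = (LEAST r. tensor_sum I X M r)"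
  by (simp add: tensor_rank_def tensor_sum_def)

lemma tensor_rank_le: "tensor_sum I X M r \<Longrightarrow> tensor_rank I X M \<le> r"
  unfolding tensor_rank_alt by (rule Least_le)

lemma tensor_sum_rank: "tensor_sum I X M r \<Longrightarrow> tensor_sum I X M (tensor_rank I X M)"
  unfolding tensor_rank_alt by (rule LeastI)

lemma tensor_sum_cong:
  assumes "tensor_sum I X M r" "\<And>x. x \<in> PiE I X \<Longrightarrow> N x = M x"
  shows "tensor_sum I X N r"
  using assms unfolding tensor_sum_def by simp

lemma tensor_sum_0: "tensor_sum I X (\<lambda>x. 0) 0"
  by (simp add: tensor_sum_def)

lemma tensor_sum_prod: "tensor_sum I X (\<lambda>x. \<Prod>l\<in>I. v l (x l)) 1"
  unfolding tensor_sum_def by (rule exI[of _ "\<lambda>_. v"]) simp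

lemma tensor_sum_add:
  assumes "tensor_sum I X M r" "tensor_sum I X N s"
  shows "tensor_sum I X (\<lambda>x. M x + N x) (r + s)"
proof -
  obtain v w where v: "\<forall>x \<in> PiE I X. M x = (\<Sum>t<r. \<Prod>l\<in>I. v t l (x l))"
    and w: "\<forall>x \<in> PiE I X. N x = (\<Sum>t<s. \<Prod>l\<in>I. w t l (x l))"
    using assms unfolding tensor_sum_def by blast
  let ?h = "\<lambda>t. if t < r then v t else w (t - r)"
  have "(\<Sum>t<r + s. \<Prod>l\<in>I. ?h t l (x l)) =
      (\<Sum>t<r. \<Prod>l\<in>I. v t l (x l)) + (\<Sum>t<s. \<Prod>l\<in>I. w t l (x l))" for x
    by (induction s) (simp_all add: add.assoc)
  then show ?thesis
    unfolding tensor_sum_def using v w by (intro exI[of _ ?h]) simp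
qed

lemma tensor_sum_sum:
  assumes "finite S" "\<And>b. b \<in> S \<Longrightarrow> tensor_sum I X (M b) r"
  shows "tensor_sum I X (\<lambda>x. \<Sum>b\<in>S. M b x) (card S * r)"
  using assms
proof (induction S)
  case empty
  then show ?case by (simp add: tensor_sum_0)
next
  case (insert b S)
  then have "tensor_sum I X (\<lambda>x. M b x + (\<Sum>b\<in>S. M b x)) (r + card S * r)"
    by (intro tensor_sum_add) auto
  with insert.hyps show ?case by simp
qed

text \<open>Extends a decomposition from a subrectangle to the whole input set by zero.\<close>

lemma tensor_sum_restrict:
  assumes "finite I" "l \<in> I" "tensor_sum I (X(l := {z \<in> X l. a z})) M r"
  shows "tensor_sum I X (\<lambda>x. if a (x l) then M x else 0) r"
proof -
  obtain v where v: "\<forall>x \<in> PiE I (X(l := {z \<in> X l. a z})). M x = (\<Sum>s<r. \<Prod>l\<in>I. v s l (x l))"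
    using assms(3) unfolding tensor_sum_def by blast
  \<comment> \<open>The indicator of \<open>a\<close>, put into the factor of player
    \<open>l\<close>, kills every product outside the subrectangle and changes nothing
    inside.\<close>
  let ?w = "\<lambda>s k z. (if k = l then of_bool (a z) else 1) * v s k z"
  have "(if a (x l) then M x else 0) = (\<Sum>s<r. \<Prod>k\<in>I. ?w s k (x k))" if x: "x \<in> PiE I X" for x
  proof (cases "a (x l)")
    case True
    with x have "x \<in> PiE I (X(l := {z \<in> X l. a z}))" by (auto simp: PiE_iff)
    then have "M x = (\<Sum>s<r. \<Prod>k\<in>I. v s k (x k))" using v by blast
    also have "\<dots> = (\<Sum>s<r. \<Prod>k\<in>I. ?w s k (x k))"
      using True by (intro sum.cong prod.cong) auto
    finally show ?thesis using True by simp
  next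
    case False
    with assms(1,2) have "(\<Prod>k\<in>I. ?w s k (x k)) = 0" for s
      by (intro prod_zero) (auto intro!: bexI[of _ l])
    with False show ?thesis by simp
  qed
  then show ?thesis unfolding tensor_sum_def by (intro exI[of _ ?w]) blast
qed

section \<open>From protocols to sums of products\<close>

text \<open>A bit of player \<open>l\<close> splits the input rectangle in two, and on each half a
  subtree runs with one bit less to spend. Extended by zero, the two decompositions add up, so the
  number of terms at most doubles per bit. The induction varies \<open>X\<close> because it descends
  to subrectangles.\<close>

lemma tensor_sum_run:
  assumes "finite I" "speakers P \<subseteq> I" "\<And>x. x \<in> PiE I X \<Longrightarrow> bits_sent P x \<le> d"
  shows "\<exists>r \<le> 2 ^ d. tensor_sum I X (\<lambda>x. of_bool (run P x)) r"
  using assms(2,3)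
proof (induction P arbitrary: X d)
  case (Output b)
  show ?case
  proof (cases b)
    case True
    have "tensor_sum I X (\<lambda>x. \<Prod>l\<in>I. 1) 1" by (rule tensor_sum_prod)
    with True show ?thesis by (intro exI[of _ 1]) simp
  next
    case False
    then show ?thesis by (intro exI[of _ 0]) (simp add: tensor_sum_0)
  qed
next
  case (Send l a P Q)
  show ?case
  \<comment> \<open>Without inputs \<open>d\<close> may be 0 even at a \<open>Send\<close> node.
    With an input, the bit sent at the root forces \<open>d = Suc e\<close>.\<close>
  proof (cases "PiE I X = {}")
    case True
    then have "tensor_sum I X (\<lambda>x. of_bool (run (Send l a P Q) x)) 0"
      by (simp add: tensor_sum_def)
    then show ?thesis by blast
  next
    case False
    with Send.prems(2) obtain e where d: "d = Suc e" by (cases d) fastforce+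
    have l: "l \<in> I" using Send.prems(1) by simp
    let ?X1 = "X(l := {z \<in> X l. a z})" and ?X0 = "X(l := {z \<in> X l. \<not> a z})"
    have bP: "bits_sent P x \<le> e" if "x \<in> PiE I ?X1" for x
    proof -
      have "x \<in> PiE I X" "a (x l)" using that l by (auto simp: PiE_iff split: if_splits)
      then show ?thesis using Send.prems(2)[of x] d by simp
    qed
    have bQ: "bits_sent Q x \<le> e" if "x \<in> PiE I ?X0" for x
    proof -
      have "x \<in> PiE I X" "\<not> a (x l)" using that l by (auto simp: PiE_iff split: if_splits)
      then show ?thesis using Send.prems(2)[of x] d by simp
    qed
    have "\<exists>r \<le> 2 ^ e. tensor_sum I ?X1 (\<lambda>x. of_bool (run P x)) r"
      by (rule Send.IH(1)[OF _ bP]) (use Send.prems(1) in auto)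
    moreover have "\<exists>s \<le> 2 ^ e. tensor_sum I ?X0 (\<lambda>x. of_bool (run Q x)) s"
      by (rule Send.IH(2)[OF _ bQ]) (use Send.prems(1) in auto)
    ultimately obtain r s where rs: "r \<le> 2 ^ e" "s \<le> 2 ^ e"
      and r: "tensor_sum I ?X1 (\<lambda>x. of_bool (run P x)) r"
      and s: "tensor_sum I ?X0 (\<lambda>x. of_bool (run Q x)) s"
      by blast
    have "tensor_sum I X (\<lambda>x. of_bool (run (Send l a P Q) x)) (r + s)"
      using tensor_sum_add[OF tensor_sum_restrict[OF assms(1) l r]
          tensor_sum_restrict[OF assms(1) l s]]
      by (rule tensor_sum_cong) simp
    moreover have "r + s \<le> 2 ^ d" using rs d by simp
    ultimately show ?thesis by blast
  qed
qed

text \<open>The classical rank lower bound on communication, read off an optimal protocol.\<close>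

lemma tensor_sum_comm_complexity:
  assumes "finite I" "finite (PiE I X)"
  shows "\<exists>r \<le> 2 ^ comm_complexity I X g. tensor_sum I X (\<lambda>x. of_bool (g x)) r"
proof -
  obtain P where P: "computes I X P g"
    "\<And>x. x \<in> PiE I X \<Longrightarrow> bits_sent P x \<le> comm_complexity I X g"
    using optimal_protocol[OF assms] by blast
  then obtain r where "r \<le> 2 ^ comm_complexity I X g"
    "tensor_sum I X (\<lambda>x. of_bool (run P x)) r"
    using tensor_sum_run[OF assms(1), of P X] unfolding computes_def by blast
  moreover from this(2) have "tensor_sum I X (\<lambda>x. of_bool (g x)) r"
    by (rule tensor_sum_cong) (use P in \<open>simp add: computes_def\<close>)
  ultimately show ?thesis by blast
qed

text \<open>A single product is nonzero exactly when all its factors are, so one bit per player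
  decides \<open>g\<close>; the empty sum makes \<open>g\<close> constantly false.\<close>

lemma comm_complexity_rank_le_1:
  assumes "finite I" "tensor_sum I X (\<lambda>x. of_bool (g x)) r" "r \<le> 1"
  shows "comm_complexity I X g \<le> card I"
proof (cases "r = 0")
  case True
  with assms(2) have "\<And>x. x \<in> PiE I X \<Longrightarrow> g x = False" by (simp add: tensor_sum_def)
  then show ?thesis using comm_complexity_const[of I X g False] by simp
next
  case False
  with assms(3) have "r = 1" by simp
  with assms(2) obtain v :: "nat \<Rightarrow> 'a \<Rightarrow> 'b \<Rightarrow> real" where
    v: "\<forall>x \<in> PiE I X. of_bool (g x) = (\<Prod>l\<in>I. v 0 l (x l))"
    unfolding tensor_sum_def by auto
  obtain ls where ls: "set ls = I" "distinct ls"
    using finite_distinct_list[OF assms(1)] by blast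
  let ?P = "conj_protocol ls (\<lambda>l z. v 0 l z \<noteq> 0) (Output True) (Output False)"
  have "run ?P x = g x" if "x \<in> PiE I X" for x
  proof -
    have "g x \<longleftrightarrow> (\<Prod>l\<in>I. v 0 l (x l)) \<noteq> 0" using v that by (metis of_bool_eq_0_iff)
    then show ?thesis using assms(1) by (simp add: run_conj_protocol ls)
  qed
  moreover have "speakers ?P \<subseteq> I"
    using speakers_conj_protocol[of ls "\<lambda>l z. v 0 l z \<noteq> 0" "Output True" "Output False"] ls
    by simp
  ultimately have "computes I X ?P g" by (simp add: computes_def)
  moreover have "bits_sent ?P x \<le> card I" for x
    using bits_sent_conj_protocol_Output distinct_card[OF ls(2)] ls(1) by metis
  ultimately show ?thesis by (rule comm_complexity_le)
qed

section \<open>Spanning rows of a low-rank matrix\<close>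

text \<open>A matrix of rank at most \<open>r\<close> has a spanning set of at most \<open>r\<close>
  of its own rows. By induction on \<open>r\<close>: either the last term vanishes on
  \<open>A\<close>, or a pivot row removes it from all rows at the price of one more spanning
  row.\<close>

lemma few_rows_span:
  fixes F :: "'a \<Rightarrow> 'b \<Rightarrow> real"
  assumes "\<And>a b. a \<in> A \<Longrightarrow> b \<in> B \<Longrightarrow> F a b = (\<Sum>s<r. u s a * w s b)"
  shows "\<exists>S c. S \<subseteq> A \<and> finite S \<and> card S \<le> r \<and>
    (\<forall>a\<in>A. \<forall>b\<in>B. F a b = (\<Sum>t\<in>S. c t a * F t b))"
  using assms
proof (induction r arbitrary: F u)
  case 0
  then show ?case by (intro exI[of _ "{}"]) simp
next
  case (Suc r)
  show ?case
  proof (cases "\<forall>a\<in>A. u r a = 0")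
    case True
    have "\<exists>S c. S \<subseteq> A \<and> finite S \<and> card S \<le> r \<and>
        (\<forall>a\<in>A. \<forall>b\<in>B. F a b = (\<Sum>t\<in>S. c t a * F t b))"
      by (rule Suc.IH[of F u]) (use Suc.prems True in simp)
    then obtain S c where "S \<subseteq> A" "finite S" "card S \<le> r"
      "\<forall>a\<in>A. \<forall>b\<in>B. F a b = (\<Sum>t\<in>S. c t a * F t b)"
      by (elim exE conjE) (rule that)
    then show ?thesis by (intro exI[of _ S] exI[of _ c] conjI) simp_all
  next
    case False
    then obtain a0 where a0: "a0 \<in> A" "u r a0 \<noteq> 0" by blast
    define q where "q a = u r a / u r a0" for a
    \<comment> \<open>Gaussian elimination of the last term, with row \<open>a0\<close> as pivot.\<close>
    define G where "G a b = F a b - q a * F a0 b" for a b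
    have "G a b = (\<Sum>s<r. (u s a - q a * u s a0) * w s b)" if "a \<in> A" "b \<in> B" for a b
    proof -
      have "q a * u r a0 = u r a" using a0 by (simp add: q_def)
      then have "q a * (u r a0 * w r b) = u r a * w r b" by (metis mult.assoc)
      then show ?thesis
        using Suc.prems[OF that] Suc.prems[OF a0(1) that(2)]
        by (auto simp: G_def algebra_simps sum_subtractf sum_distrib_left)
    qed
    from Suc.IH[of G "\<lambda>s a. u s a - q a * u s a0", OF this] obtain S c
      where S: "S \<subseteq> A" "finite S" "card S \<le> r"
        and c: "\<forall>a\<in>A. \<forall>b\<in>B. G a b = (\<Sum>t\<in>S. c t a * G t b)"
      by auto
    \<comment> \<open>Obtained by expanding \<open>G\<close> in its row relation: row
      \<open>a0\<close> collects all pivot corrections. The two indicators add both contributions in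
      case \<open>a0\<close> already lies in \<open>S\<close>.\<close>
    define e where "e t a = of_bool (t \<in> S) * c t a +
      of_bool (t = a0) * (q a - (\<Sum>t\<in>S. c t a * q t))" for t a
    have "F a b = (\<Sum>t\<in>insert a0 S. e t a * F t b)" if "a \<in> A" "b \<in> B" for a b
    proof -
      have "(\<Sum>t\<in>insert a0 S. e t a * F t b) =
          (\<Sum>t\<in>insert a0 S. if t \<in> S then c t a * F t b else 0) +
          (\<Sum>t\<in>insert a0 S. if t = a0 then (q a - (\<Sum>t\<in>S. c t a * q t)) * F t b else 0)"
        unfolding sum.distrib[symmetric] by (intro sum.cong) (auto simp: e_def algebra_simps)
      also have "(\<Sum>t\<in>insert a0 S. if t \<in> S then c t a * F t b else 0) = (\<Sum>t\<in>S. c t a * F t b)"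
        using S(2) by (intro sum.mono_neutral_cong_right) auto
      also have "(\<Sum>t\<in>insert a0 S. if t = a0 then (q a - (\<Sum>t\<in>S. c t a * q t)) * F t b else 0) =
          (q a - (\<Sum>t\<in>S. c t a * q t)) * F a0 b"
        using S(2) by (subst sum.delta) auto
      also have "(\<Sum>t\<in>S. c t a * F t b) + (q a - (\<Sum>t\<in>S. c t a * q t)) * F a0 b =
          (\<Sum>t\<in>S. c t a * G t b) + q a * F a0 b"
        by (simp add: G_def algebra_simps sum_subtractf sum_distrib_left)
      also have "\<dots> = F a b"
        using c that by (metis G_def diff_add_cancel)
      finally show ?thesis by simp
    qed
    moreover have "card (insert a0 S) \<le> Suc r" using S by (simp add: card_insert_if)
    ultimately show ?thesis using S a0 by (intro exI[of _ "insert a0 S"] exI[of _ e]) auto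
  qed
qed

subsection \<open>Induced functions\<close>

lemma finite_bit_strings: "finite (bit_strings n)"
  using finite_lists_length_eq[of "UNIV :: bool set" n] by (simp add: bit_strings_def)

text \<open>The two-party view of an input of \<open>f\<close>, a right inverse of the
  \<open>merge\<close> in \<open>induced\<close>. The restrictions make both halves extensional, as
  \<open>induced_inputs\<close> demands.\<close>

definition induced_input ::
    "nat set \<Rightarrow> nat set \<Rightarrow> (nat \<Rightarrow> bool list) \<Rightarrow> nat \<Rightarrow> nat \<Rightarrow> bool list" where
  "induced_input A B x = (\<lambda>p\<in>{1, 2}. restrict x (if p = 1 then A else B))"

lemma induced_input_in:
  assumes "x \<in> A \<union> B \<rightarrow>\<^sub>E bit_strings n"
  shows "induced_input A B x \<in> PiE {1, 2} (induced_inputs n A B)"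
  using assms by (auto simp: induced_input_def induced_inputs_def)

lemma induced_induced_input:
  assumes "x \<in> A \<union> B \<rightarrow>\<^sub>E bit_strings n"
  shows "induced A B f (induced_input A B x) = f x"
proof -
  have "merge A B (restrict x A, restrict x B) = x"
    using assms by (auto simp: merge_def fun_eq_iff PiE_iff extensional_def)
  then show ?thesis by (simp add: induced_def induced_input_def)
qed

lemma finite_induced_inputs:
  assumes "finite A" "finite B"
  shows "finite (PiE {1, 2} (induced_inputs n A B))"
  using assms by (intro finite_PiE) (auto simp: induced_inputs_def finite_bit_strings intro!: finite_PiE)

text \<open>Every input of \<open>f\<close> has a two-party view, so constancy of the induced
  function passes to \<open>f\<close>. This serves the case in which the final bound is 0.\<close>

lemma induced_complexity_0_const:
  assumes "finite A" "finite B" "induced_complexity n A B f = 0"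
  shows "\<exists>b. \<forall>x \<in> A \<union> B \<rightarrow>\<^sub>E bit_strings n. f x = b"
  using comm_complexity_0_const[OF _ finite_induced_inputs[OF assms(1,2)], of n "induced A B f"]
    assms(3) induced_input_in induced_induced_input
  unfolding induced_complexity_def by (metis finite.emptyI finite.insertI)

lemma induced_decomposition:
  assumes "finite A" "finite B"
  shows "\<exists>r::nat. r \<le> 2 ^ induced_complexity n A B f \<and> (\<exists>u w. \<forall>x \<in> A \<union> B \<rightarrow>\<^sub>E bit_strings n.
    of_bool (f x) = (\<Sum>s<r. u s (restrict x A) * w s (restrict x B) :: real))"
proof -
  obtain r and v :: "nat \<Rightarrow> nat \<Rightarrow> (nat \<Rightarrow> bool list) \<Rightarrow> real"
    where r: "r \<le> 2 ^ induced_complexity n A B f"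
      and v: "\<forall>y \<in> PiE {1, 2} (induced_inputs n A B).
        of_bool (induced A B f y) = (\<Sum>s<r. \<Prod>l\<in>{1, 2}. v s l (y l))"
    using tensor_sum_comm_complexity[OF _ finite_induced_inputs[OF assms], of n "induced A B f"]
    unfolding tensor_sum_def induced_complexity_def by auto
  have "of_bool (f x) = (\<Sum>s<r. v s 1 (restrict x A) * v s 2 (restrict x B))"
    if x: "x \<in> A \<union> B \<rightarrow>\<^sub>E bit_strings n" for x
    using v[rule_format, OF induced_input_in[OF x]] induced_induced_input[OF x]
    by (simp add: induced_input_def)
  then have "\<exists>u w. \<forall>x \<in> A \<union> B \<rightarrow>\<^sub>E bit_strings n.
      of_bool (f x) = (\<Sum>s<r. u s (restrict x A) * w s (restrict x B) :: real)"
    by (rule_tac x = "\<lambda>s. v s 1" in exI, rule_tac x = "\<lambda>s. v s 2" in exI) simp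
  with r show ?thesis by blast
qed

section \<open>Combining two cuts of a three-party function\<close>

text \<open>The cut at \<open>i\<close> expresses \<open>f x\<close> through slices
  \<open>f (x(i := b))\<close> with coefficients depending on \<open>x i\<close>. The cut at
  \<open>j\<close> then splits each slice: with \<open>b\<close> fixed, the side opposite
  \<open>j\<close> depends only on the input of the third player.\<close>

lemma tensor_sum_induced:
  assumes "i \<in> {1..3}" "j \<in> {1..3}" "i \<noteq> j"
  shows "\<exists>r \<le> 2 ^ (induced_complexity n {i} ({1..3} - {i}) f +
      induced_complexity n {j} ({1..3} - {j}) f).
    tensor_sum {1..3} (\<lambda>_. bit_strings n) (\<lambda>x. of_bool (f x)) r"
proof -
  let ?I = "{1..3::nat}" and ?W = "bit_strings n"
  \<comment> \<open>The third player is \<open>6 - i - j\<close>, since 1 + 2 + 3 = 6.\<close>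
  obtain k where k: "?I = {i, j, k}" "k \<noteq> i" "k \<noteq> j"
  proof
    have "i = 1 \<or> i = 2 \<or> i = 3" "j = 1 \<or> j = 2 \<or> j = 3" using assms by auto
    then show "?I = {i, j, 6 - i - j}" "6 - i - j \<noteq> i" "6 - i - j \<noteq> j"
      using assms(3) by auto
  qed
  have I: "{i} \<union> (?I - {i}) = ?I" "{j} \<union> (?I - {j}) = ?I" using assms by auto
  obtain r :: nat and u w where r: "r \<le> 2 ^ induced_complexity n {i} (?I - {i}) f"
    and uw: "\<forall>x \<in> ?I \<rightarrow>\<^sub>E ?W. of_bool (f x) =
      (\<Sum>s<r. u s (restrict x {i}) * w s (restrict x (?I - {i})) :: real)"
    using induced_decomposition[of "{i}" "?I - {i}" n f] unfolding I by blast
  obtain r' :: nat and p q where r': "r' \<le> 2 ^ induced_complexity n {j} (?I - {j}) f"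
    and pq: "\<forall>x \<in> ?I \<rightarrow>\<^sub>E ?W. of_bool (f x) =
      (\<Sum>s<r'. p s (restrict x {j}) * q s (restrict x (?I - {j})) :: real)"
    using induced_decomposition[of "{j}" "?I - {j}" n f] unfolding I by blast
  have upd: "x(i := a) \<in> ?I \<rightarrow>\<^sub>E ?W" if "a \<in> ?W" "x \<in> ?I \<rightarrow>\<^sub>E ?W" for a x
    using that assms(1) by (auto simp: PiE_iff extensional_def)
  have slice: "of_bool (f (x(i := a))) = (\<Sum>s<r. u s (\<lambda>l\<in>{i}. a) * w s (restrict x (?I - {i})))"
    if "a \<in> ?W" "x \<in> ?I \<rightarrow>\<^sub>E ?W" for a x
  proof -
    have "restrict (x(i := a)) {i} = (\<lambda>l\<in>{i}. a)"
      "restrict (x(i := a)) (?I - {i}) = restrict x (?I - {i})"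
      by (auto simp: restrict_def)
    then show ?thesis using uw upd[OF that] by simp
  qed
  \<comment> \<open>Rows are the inputs \<open>a\<close> of player \<open>i\<close>. Columns are
    whole inputs \<open>x\<close>, whose entry at \<open>i\<close> is overwritten, so no separate
    index set for the other two players arises.\<close>
  have "\<exists>S c. S \<subseteq> ?W \<and> finite S \<and> card S \<le> r \<and> (\<forall>a\<in>?W. \<forall>x \<in> ?I \<rightarrow>\<^sub>E ?W.
      of_bool (f (x(i := a))) = (\<Sum>b\<in>S. c b a * of_bool (f (x(i := b))) :: real))"
    by (rule few_rows_span[of ?W "?I \<rightarrow>\<^sub>E ?W" "\<lambda>a x. of_bool (f (x(i := a)))"
          "\<lambda>s a. u s (\<lambda>l\<in>{i}. a)" "\<lambda>s x. w s (restrict x (?I - {i}))"]) (rule slice)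
  then obtain S c where S: "S \<subseteq> ?W" "finite S" "card S \<le> r"
    and c: "\<forall>a\<in>?W. \<forall>x \<in> ?I \<rightarrow>\<^sub>E ?W.
      of_bool (f (x(i := a))) = (\<Sum>b\<in>S. c b a * of_bool (f (x(i := b))) :: real)"
    by (elim exE conjE) (rule that)
  \<comment> \<open>A tensor factor sees only its own player's input \<open>z\<close>, so the
    arguments of \<open>p\<close> and \<open>q\<close> are rebuilt from it, with \<open>b\<close>
    hard-wired at position \<open>i\<close>.\<close>
  let ?m = "\<lambda>b t l z. if l = i then c b z else if l = j then p t (\<lambda>l\<in>{j}. z)
    else q t (\<lambda>l\<in>?I - {j}. if l = i then b else z)"
  have "tensor_sum ?I (\<lambda>_. ?W) (\<lambda>x. \<Sum>b\<in>S. \<Sum>t<r'. \<Prod>l\<in>?I. ?m b t l (x l))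
      (card S * (card {..<r'} * 1))"
    using S(2) by (intro tensor_sum_sum tensor_sum_prod) simp_all
  then have "tensor_sum ?I (\<lambda>_. ?W) (\<lambda>x. of_bool (f x)) (card S * (card {..<r'} * 1))"
  proof (rule tensor_sum_cong)
    fix x assume x: "x \<in> ?I \<rightarrow>\<^sub>E ?W"
    then have xi: "x i \<in> ?W" using assms(1) by auto
    have "of_bool (f (x(i := b))) =
        (\<Sum>t<r'. p t (\<lambda>l\<in>{j}. x j) * q t (\<lambda>l\<in>?I - {j}. if l = i then b else x k))"
      if "b \<in> S" for b
    proof -
      have "restrict (x(i := b)) {j} = (\<lambda>l\<in>{j}. x j)"
        "restrict (x(i := b)) (?I - {j}) = (\<lambda>l\<in>?I - {j}. if l = i then b else x k)"
        using assms(3) k by (auto simp: restrict_def fun_eq_iff)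
      moreover have "x(i := b) \<in> ?I \<rightarrow>\<^sub>E ?W" using upd x S(1) that by blast
      ultimately show ?thesis using pq by metis
    qed
    moreover have "(\<Prod>l\<in>?I. ?m b t l (x l)) = c b (x i) *
        (p t (\<lambda>l\<in>{j}. x j) * q t (\<lambda>l\<in>?I - {j}. if l = i then b else x k))" for b t
      unfolding k(1) using assms(3) k(2,3) by (auto simp: eq_commute)
    \<comment> \<open>The row relation is taken at \<open>a = x i\<close>, where the update leaves
      \<open>x\<close> unchanged.\<close>
    ultimately show "of_bool (f x) = (\<Sum>b\<in>S. \<Sum>t<r'. \<Prod>l\<in>?I. ?m b t l (x l))"
      using c[rule_format, OF xi x] by (simp add: sum_distrib_left)
  qed
  moreover have "card S * (card {..<r'} * 1) \<le> 2 ^ induced_complexity n {i} (?I - {i}) f *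
      2 ^ induced_complexity n {j} (?I - {j}) f"
    using S(3) r r' by (auto intro!: mult_le_mono)
  ultimately show ?thesis by (auto simp: power_add)
qed

section \<open>From the rank bound to communication\<close>

theorem theorem2:
  fixes c' :: real
  assumes "c' > 0"
    and "log_rank_conjecture 3 c'"
  shows "\<exists>C>0. \<forall>n. \<forall>f :: (nat \<Rightarrow> bool list) \<Rightarrow> bool.
           \<forall>i\<in>{1..3}. \<forall>j\<in>{1..3}. i \<noteq> j \<longrightarrow>
             real (boolfun_complexity 3 n f) \<le>
               C * (real (induced_complexity n {i} ({1..3} - {i}) f) +
                    real (induced_complexity n {j} ({1..3} - {j}) f)) powr c'"
proof -
  obtain C where "C > 0" and C: "\<And>n g. boolfun_rank 3 n g \<ge> 2 \<Longrightarrow>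
      real (boolfun_complexity 3 n g) \<le> C * (log 2 (real (boolfun_rank 3 n g))) powr c'"
    using assms(2) unfolding log_rank_conjecture_def by blast
  \<comment> \<open>\<open>C\<close> serves rank at least 2. The constant 3, one bit per player,
    serves rank at most 1, since a nonzero \<open>?d\<close> has \<open>?d powr c'\<close> at least
    1.\<close>
  have "real (boolfun_complexity 3 n f) \<le> max C 3 * real (induced_complexity n {i} ({1..3} - {i}) f +
      induced_complexity n {j} ({1..3} - {j}) f) powr c'" (is "_ \<le> _ * real ?d powr c'")
    if ij: "i \<in> {1..3}" "j \<in> {1..3}" "i \<noteq> j" for n f i j
  proof (cases "?d = 0")
    case True
    have "{i} \<union> ({1..3} - {i}) = {1..3}" using ij by auto
    with True obtain b where "\<forall>x \<in> {1..3} \<rightarrow>\<^sub>E bit_strings n. f x = b"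
      using induced_complexity_0_const[of "{i}" "{1..3} - {i}" n f] by auto
    then have "boolfun_complexity 3 n f = 0"
      unfolding boolfun_complexity_def by (intro comm_complexity_const) blast
    then show ?thesis by simp
  next
    case False
    obtain r where r: "r \<le> 2 ^ ?d"
      "tensor_sum {1..3} (\<lambda>_. bit_strings n) (\<lambda>x. of_bool (f x)) r"
      using tensor_sum_induced[OF ij] by blast
    let ?R = "boolfun_rank 3 n f"
    have R: "tensor_sum {1..3} (\<lambda>_. bit_strings n) (\<lambda>x. of_bool (f x)) ?R"
      unfolding boolfun_rank_def using r(2) by (rule tensor_sum_rank)
    have "?R \<le> 2 ^ ?d"
      unfolding boolfun_rank_def using tensor_rank_le[OF r(2)] r(1) by simp
    then have le: "real ?R \<le> 2 ^ ?d" by (metis of_nat_le_iff of_nat_numeral of_nat_power)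
    show ?thesis
    proof (cases "?R \<ge> 2")
      case True
      then have "log 2 (real ?R) \<le> real ?d"
        using le by (simp add: log_le_iff powr_realpow del: of_nat_add)
      moreover have "0 \<le> log 2 (real ?R)" using True by simp
      ultimately have "log 2 (real ?R) powr c' \<le> real ?d powr c'"
        using assms(1) by (intro powr_mono2) auto
      then have "C * log 2 (real ?R) powr c' \<le> max C 3 * real ?d powr c'"
        using \<open>C > 0\<close> by (intro mult_mono) auto
      with C[OF True] show ?thesis by linarith
    next
      case small: False
      have "boolfun_complexity 3 n f \<le> 3"
        unfolding boolfun_complexity_def using comm_complexity_rank_le_1[OF _ R] small by simp
      moreover have "1 \<le> real ?d powr c'"
        using False assms(1) by (intro ge_one_powr_ge_zero) linarith+
      then have "3 * 1 \<le> max C 3 * real ?d powr c'" by (intro mult_mono) auto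
      ultimately show ?thesis by linarith
    qed
  qed
  then show ?thesis
    using \<open>C > 0\<close> by (intro exI[of _ "max C 3"]) (simp add: of_nat_add)
qed

end
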